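(* Let $p$ be an odd prime, $g$ a primitive root modulo $p$, $d$ a positive divisor of $p-1$, $k=(p-1)/d$, $e_p(x)=e^{2\pi i x/p}$, $\eta_a=\sum_{j=0}^{k-1}e_p(g^{dj+a})$, and $V_4(p)=\sum_{s=0}^{d-1}|\eta_s|^4$. Then (a) $\displaystyle\frac{((d-1)p+1)^2}{d^3}\le V_4(p)$, and (b) $\displaystyle V_4(p)\le\frac{1}{d^3}\Big((d-1)(d^2-3d+3)p^2+4(d-1)(d-2)p^{3/2}+6(d-1)p+1\Big)$. *)

theory Defs
  imports "HOL-Analysis.Analysis" "HOL-Number_Theory.Residue_Primitive_Roots"
begin

definition e_mod :: "nat \<Rightarrow> real \<Rightarrow> complex" where
  "e_mod p x = exp (2 * of_real pi * \<i> * of_real x / of_nat p)"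

text \<open>
  The Gaussian period \<open>\<eta>\<^sub>a\<close> of order \<open>d\<close>, that is with \<open>k = (p - 1) / d\<close> terms.
  It is only meaningful when \<open>d\<close> divides \<open>p - 1\<close>.
\<close>

definition gauss_period :: "nat \<Rightarrow> nat \<Rightarrow> nat \<Rightarrow> nat \<Rightarrow> complex" where
  "gauss_period p g d a = (\<Sum>j<(p - 1) div d. e_mod p (real (g ^ (d * j + a))))"

definition V4 :: "nat \<Rightarrow> nat \<Rightarrow> nat \<Rightarrow> real" where
  "V4 p g d = (\<Sum>s<d. cmod (gauss_period p g d s) ^ 4)"

end

theory Submission
  imports Defs
begin

text \<open>
  Let \<open>G\<^sub>t = \<Sum>\<^sub>s \<zeta>\<^bsup>ts\<^esup> \<eta>\<^sub>s\<close> with \<open>\<zeta> = exp (2\<pi>\<i>/d)\<close> be the discrete Fourier transform of the periods.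
  Here \<open>G\<^sub>t\<close> is the Gauss sum of the character \<open>g\<^sup>n \<mapsto> \<zeta>\<^bsup>tn\<^esup>\<close>, so \<open>G\<^sub>0 = -1\<close> and
  \<open>|G\<^sub>t|\<^sup>2 = p\<close> for \<open>0 < t < d\<close>. Applying Parseval's identity to \<open>s \<mapsto> |\<eta>\<^sub>s|\<^sup>2\<close>, whose transform is
  the correlation \<open>A\<^sub>r / d\<close> with \<open>A\<^sub>r = \<Sum>\<^sub>u G\<^bsub>u+r\<^esub> cnj G\<^sub>u\<close>, gives \<open>d\<^sup>3 V\<^sub>4 = \<Sum>\<^sub>r |A\<^sub>r|\<^sup>2\<close>.
  The term \<open>A\<^sub>0 = (d - 1)p + 1\<close> alone is the lower bound. For \<open>r \<noteq> 0\<close>, exactly the two terms of \<open>A\<^sub>r\<close>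
  that involve \<open>G\<^sub>0\<close> have modulus \<open>\<surd>p\<close> and the other \<open>d - 2\<close> have modulus \<open>p\<close>, which yields the
  upper bound.
\<close>

section \<open>Additive characters and Parseval's identity\<close>

lemma e_mod_add: "e_mod n (x + y) = e_mod n x * e_mod n y"
  by (simp add: e_mod_def exp_add[symmetric] ring_distribs add_divide_distrib)

lemma e_mod_0 [simp]: "e_mod n 0 = 1"
  by (simp add: e_mod_def)

lemma norm_e_mod [simp]: "cmod (e_mod n x) = 1"
proof -
  have "e_mod n x = cis (2 * pi * x / n)"
    by (simp add: e_mod_def cis_conv_exp mult_ac)
  then show ?thesis by simp
qed

lemma e_mod_eq_1_iff:
  assumes "n > 0"
  shows "e_mod n (of_int k) = 1 \<longleftrightarrow> int n dvd k"
proof -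
  have eq: "2 * complex_of_real pi * \<i> * of_real (of_int k) / of_nat n
      = \<i> * of_real (2 * pi * of_int k / n)"
    by simp
  have "e_mod n (of_int k) = 1 \<longleftrightarrow> (\<exists>m::int. 2 * pi * of_int k / n = of_int (2 * m) * pi)"
    unfolding e_mod_def eq exp_eq_1 by simp
  also have "\<dots> \<longleftrightarrow> (\<exists>m::int. real_of_int k = of_int (int n * m))"
    using assms by (intro ex_cong1) (simp add: field_simps)
  also have "\<dots> \<longleftrightarrow> int n dvd k"
    by (simp only: of_int_eq_iff dvd_def)
  finally show ?thesis .
qed

lemma e_mod_cnj: "cnj (e_mod n x) = e_mod n (- x)"
  by (simp add: e_mod_def exp_cnj)

lemma e_mod_power: "e_mod n (real t * x) = e_mod n x ^ t"
  by (induction t) (simp_all add: e_mod_add distrib_right)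

lemma e_mod_cong:
  assumes "n > 0" "[a = b] (mod n)"
  shows "e_mod n (real a) = e_mod n (real b)"
proof -
  have "e_mod n (of_int (int a - int b)) = 1"
    using assms by (simp only: e_mod_eq_1_iff) (simp add: cong_iff_dvd_diff flip: cong_int_iff)
  moreover have "e_mod n (real a) = e_mod n (of_int (int a - int b)) * e_mod n (real b)"
    by (simp flip: e_mod_add)
  ultimately show ?thesis by simp
qed

text \<open>The summands are the powers of an \<open>n\<close>-th root of unity \<open>z\<close>,
  which is 1 exactly in the congruent case; otherwise the geometric sum vanishes.\<close>

lemma e_mod_orthogonal:
  assumes "n > 0"
  shows "(\<Sum>t<n. e_mod n (real (t * a)) * cnj (e_mod n (real (t * b))))
    = (if [a = b] (mod n) then of_nat n else 0)"
proof -
  define z where "z = e_mod n (of_int (int a - int b))"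
  have z: "z = 1 \<longleftrightarrow> [a = b] (mod n)"
    unfolding z_def using assms
    by (simp only: e_mod_eq_1_iff) (simp add: cong_iff_dvd_diff flip: cong_int_iff)
  have "z ^ n = e_mod n (of_int (int n * (int a - int b)))"
    by (simp add: z_def flip: e_mod_power)
  also have "\<dots> = 1"
    using assms by (subst e_mod_eq_1_iff) auto
  finally have zn: "z ^ n = 1" .
  have "e_mod n (real (t * a)) * cnj (e_mod n (real (t * b))) = z ^ t" for t
    by (simp add: z_def e_mod_cnj flip: e_mod_power e_mod_add) (simp add: algebra_simps)
  then show ?thesis
    using z zn by (cases "z = 1") (simp_all add: geometric_sum)
qed

text \<open>Arbitrary incongruent frequencies \<open>x i\<close> cover two uses: modulo
  \<open>d\<close> with \<open>x\<close> the identity, and modulo \<open>p\<close> with the powers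
  of \<open>g\<close>.\<close>

lemma e_mod_parseval:
  assumes "n > 0" "finite I" and inj: "\<And>i j. i \<in> I \<Longrightarrow> j \<in> I \<Longrightarrow> [x i = x j] (mod n) \<Longrightarrow> i = j"
  shows "(\<Sum>t<n. (\<Sum>i\<in>I. e_mod n (real (t * x i)) * f i) * cnj (\<Sum>i\<in>I. e_mod n (real (t * x i)) * h i))
    = of_nat n * (\<Sum>i\<in>I. f i * cnj (h i))"
proof -
  have "(\<Sum>t<n. (\<Sum>i\<in>I. e_mod n (real (t * x i)) * f i) * cnj (\<Sum>i\<in>I. e_mod n (real (t * x i)) * h i))
    = (\<Sum>t<n. \<Sum>i\<in>I. \<Sum>j\<in>I. (e_mod n (real (t * x i)) * cnj (e_mod n (real (t * x j)))) * (f i * cnj (h j)))"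
    by (simp add: sum_product mult_ac)
  also have "\<dots> = (\<Sum>i\<in>I. \<Sum>j\<in>I. (\<Sum>t<n. e_mod n (real (t * x i)) * cnj (e_mod n (real (t * x j)))) * (f i * cnj (h j)))"
    by (simp only: sum_distrib_right sum.swap[where A = "{..<n}"])
  also have "\<dots> = (\<Sum>i\<in>I. \<Sum>j\<in>I. if j = i then of_nat n * (f i * cnj (h j)) else 0)"
    unfolding e_mod_orthogonal[OF \<open>n > 0\<close>]
    by (intro sum.cong refl) (auto dest: inj)
  also have "\<dots> = of_nat n * (\<Sum>i\<in>I. f i * cnj (h i))"
    using \<open>finite I\<close> by (simp add: sum_distrib_left)
  finally show ?thesis .
qed

lemma e_mod_parseval_norm:
  assumes "n > 0" "finite I" "\<And>i j. i \<in> I \<Longrightarrow> j \<in> I \<Longrightarrow> [x i = x j] (mod n) \<Longrightarrow> i = j"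
  shows "(\<Sum>t<n. (cmod (\<Sum>i\<in>I. e_mod n (real (t * x i)) * f i))\<^sup>2) = real n * (\<Sum>i\<in>I. (cmod (f i))\<^sup>2)"
proof -
  have "complex_of_real (\<Sum>t<n. (cmod (\<Sum>i\<in>I. e_mod n (real (t * x i)) * f i))\<^sup>2)
      = complex_of_real (real n * (\<Sum>i\<in>I. (cmod (f i))\<^sup>2))"
    unfolding of_real_sum of_real_mult of_real_of_nat_eq complex_norm_square
    by (rule e_mod_parseval[OF assms])
  then show ?thesis by (simp only: of_real_eq_iff)
qed

section \<open>Sums over a period and primitive roots\<close>

lemma sum_periodic_shift:
  fixes F :: "nat \<Rightarrow> 'a::ab_group_add"
  assumes "\<And>n. F (n + N) = F n"
  shows "(\<Sum>n<N. F (n + m)) = (\<Sum>n<N. F n)"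
proof (induction m)
  case (Suc m)
  \<comment> \<open>Moving the window by one step trades \<open>F m\<close> for
    \<open>F (N + m)\<close>, which are equal.\<close>
  have "(\<Sum>n<N. F (Suc n + m)) + F m = (\<Sum>n<N. F (n + m)) + F (N + m)"
    using sum.lessThan_Suc_shift[of "\<lambda>n. F (n + m)" N] by (simp add: add.commute)
  with Suc assms[of m] show ?case by (simp add: add.commute)
qed simp

lemma prime_bij_betw_primroot:
  assumes "prime p" "residue_primroot p g"
  shows "bij_betw (\<lambda>i. g ^ i mod p) {..<p - 1} {1..<p}"
proof -
  have "totatives p = {1..<p}"
    using assms(1) by (auto simp: totatives_prime)
  then show ?thesis
    using residue_primroot_is_generator[of p g] assms prime_gt_1_nat[of p]
    by (simp add: totient_prime)
qed

section \<open>Gauss sums and their moduli\<close>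

definition gauss_sum :: "nat \<Rightarrow> nat \<Rightarrow> nat \<Rightarrow> nat \<Rightarrow> complex" where
  "gauss_sum p g d t = (\<Sum>s<d. e_mod d (real (t * s)) * gauss_period p g d s)"

context
  fixes p g d :: nat
  assumes p: "prime p" and g: "residue_primroot p g" and d: "d > 0" "d dvd p - 1"
begin

lemma primroot_pow_cong: "[g ^ (p - 1) = 1] (mod p)"
  using p g by (metis residue_primroot_def coprime_commute euler_theorem totient_prime)

lemma e_mod_dvd: "d dvd a \<Longrightarrow> e_mod d (real a) = 1"
  using e_mod_cong[of d a 0] d by (simp add: cong_0_iff)

text \<open>Each \<open>n < p - 1\<close> is uniquely \<open>s + j * d\<close> with
  \<open>s < d\<close>, and the character value at \<open>n\<close> depends only on
  \<open>s\<close>, so the double sum flattens.\<close>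

lemma gauss_sum_altdef:
  "gauss_sum p g d t = (\<Sum>n<p - 1. e_mod d (real (t * n)) * e_mod p (real (g ^ n)))"
proof -
  define F where "F n = e_mod d (real (t * n)) * e_mod p (real (g ^ n))" for n
  have "e_mod d (real (t * (j * d + s))) = e_mod d (real (t * s))" for j s
    by (rule e_mod_cong) (use d in \<open>auto simp: cong_def algebra_simps\<close>)
  then have F: "e_mod d (real (t * s)) * e_mod p (real (g ^ (d * j + s))) = F (s + j * d)" for j s
    unfolding F_def by (metis add.commute mult.commute)
  have "gauss_sum p g d t = (\<Sum>j<(p - 1) div d. \<Sum>s<d. F (s + j * d))"
    unfolding gauss_sum_def gauss_period_def sum_distrib_left F by (rule sum.swap)
  also have "\<dots> = (\<Sum>j<(p - 1) div d. sum F {j * d..<j * d + d})"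
    using sum.shift_bounds_nat_ivl[of F 0 _ d] by (simp add: atLeast0LessThan add.commute[of d])
  also have "\<dots> = sum F {..<p - 1}"
    using d by (simp add: sum.nat_group)
  finally show ?thesis by (simp add: F_def)
qed

lemma sum_primroot_powers:
  fixes f :: "nat \<Rightarrow> 'a::ab_group_add"
  assumes "\<And>a. f (a mod p) = f a"
  shows "(\<Sum>n<p - 1. f (g ^ n)) = (\<Sum>a<p. f a) - f 0"
proof -
  have "(\<Sum>n<p - 1. f (g ^ n)) = (\<Sum>a\<in>{1..<p}. f a)"
    using sum.reindex_bij_betw[OF prime_bij_betw_primroot[OF p g], of f] by (simp add: assms)
  also have "\<dots> = (\<Sum>a<p. f a) - f 0"
    using prime_gt_0_nat[OF p] by (simp add: sum.atLeast_Suc_lessThan atLeast0LessThan[symmetric])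
  finally show ?thesis .
qed

text \<open>All weights are 1, which leaves the sum of the \<open>p\<close>-th roots of unity other
  than 1.\<close>

lemma gauss_sum_trivial:
  assumes "d dvd t"
  shows "gauss_sum p g d t = - 1"
proof -
  have "gauss_sum p g d t = (\<Sum>n<p - 1. e_mod p (real (g ^ n)))"
    using assms unfolding gauss_sum_altdef by (simp add: e_mod_dvd del: of_nat_mult)
  also have "\<dots> = (\<Sum>a<p. e_mod p (real a)) - 1"
    using prime_gt_0_nat[OF p]
    by (subst sum_primroot_powers[of "\<lambda>a. e_mod p (real a)"]) (auto intro!: e_mod_cong)
  also have "(\<Sum>a<p. e_mod p (real a)) = 0"
    using e_mod_orthogonal[of p 1 0] prime_gt_1_nat[OF p] by (simp add: cong_def)
  finally show ?thesis by simp
qed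

text \<open>
  The sums \<open>S a\<close> twisted by \<open>a\<close> all have the modulus of the Gauss sum for \<open>a\<close> prime to \<open>p\<close>, and \<open>S 0 = 0\<close>,
  so Parseval's identity modulo \<open>p\<close> determines this modulus.
\<close>
lemma norm_gauss_sum:
  assumes "\<not> d dvd t"
  shows "(cmod (gauss_sum p g d t))\<^sup>2 = real p"
proof -
  have p0: "p > 0" and p1: "p > 1" using p prime_gt_1_nat by (auto intro: prime_gt_0_nat)
  define S where "S a = (\<Sum>n<p - 1. e_mod p (real (a * g ^ n)) * e_mod d (real (t * n)))" for a
  define F where "F n = e_mod d (real (t * n)) * e_mod p (real (g ^ n))" for n
  have F_periodic: "F (n + (p - 1)) = F n" for n
  proof -
    have "[t * (n + (p - 1)) = t * n] (mod d)"
      using cong_add[OF cong_refl, of "t * (p - 1)" 0 d "t * n"] d(2)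
      by (simp add: distrib_left cong_0_iff dvd_mult del: diff_mult_distrib2)
    moreover have "[g ^ (n + (p - 1)) = g ^ n] (mod p)"
      using cong_mult[OF cong_refl primroot_pow_cong, of "g ^ n"] by (simp add: power_add)
    ultimately show ?thesis
      unfolding F_def using d p0 by (metis e_mod_cong)
  qed
  \<comment> \<open>Replacing \<open>n\<close> by \<open>n + m\<close> pulls out a factor of modulus
    1 and twists the additive character by \<open>g ^ m\<close>.\<close>
  have "gauss_sum p g d t = e_mod d (real (t * m)) * S (g ^ m)" for m
  proof -
    have "gauss_sum p g d t = (\<Sum>n<p - 1. F (n + m))"
      unfolding sum_periodic_shift[of F, OF F_periodic] by (simp only: gauss_sum_altdef F_def[abs_def])
    also have "\<dots> = e_mod d (real (t * m)) * S (g ^ m)"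
      unfolding S_def F_def sum_distrib_left
      by (intro sum.cong refl) (simp add: e_mod_add distrib_left power_add mult_ac)
    finally show ?thesis .
  qed
  then have norm_S: "cmod (S (g ^ m)) = cmod (gauss_sum p g d t)" for m
    by (metis norm_mult norm_e_mod mult_1)
  have S_mod: "S (a mod p) = S a" for a
    unfolding S_def
    by (intro sum.cong refl arg_cong2[where f = "(*)"] e_mod_cong p0) (simp add: cong_def mod_mult_left_eq)
  \<comment> \<open>This is a nontrivial character summed over the whole group: a geometric sum with
    ratio \<open>z\<close> different from 1 and \<open>z ^ (p - 1) = 1\<close>.\<close>
  have "S 0 = 0"
  proof -
    define z where "z = e_mod d (real t)"
    have "z \<noteq> 1"
      using assms e_mod_eq_1_iff[of d "int t"] d by (simp add: z_def)
    moreover have "e_mod d (real (t * n)) = z ^ n" for n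
      by (simp add: z_def mult.commute flip: e_mod_power)
    moreover have "e_mod d (real (t * (p - 1))) = 1"
      using d by (intro e_mod_dvd) simp
    ultimately show ?thesis
      unfolding S_def by (simp add: geometric_sum del: of_nat_mult)
  qed
  moreover have "(\<Sum>a<p. (cmod (S a))\<^sup>2) = real p * real (p - 1)"
  proof -
    have inj: "i = j" if "i \<in> {..<p - 1}" "j \<in> {..<p - 1}" "[g ^ i = g ^ j] (mod p)" for i j
      using that prime_bij_betw_primroot[OF p g] by (auto simp: bij_betw_def inj_on_def cong_def)
    show ?thesis
      unfolding S_def by (subst e_mod_parseval_norm[OF p0 finite_lessThan inj]) auto
  qed
  moreover have "(\<Sum>n<p - 1. (cmod (S (g ^ n)))\<^sup>2) = (\<Sum>a<p. (cmod (S a))\<^sup>2) - (cmod (S 0))\<^sup>2"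
    by (rule sum_primroot_powers) (simp add: S_mod)
  \<comment> \<open>The two evaluations give \<open>(p - 1) * |G|^2 = p * (p - 1)\<close>, with
    \<open>p - 1\<close> nonzero.\<close>
  ultimately show ?thesis using p1 by (simp add: norm_S)
qed

lemma sum_norm_gauss_sum: "(\<Sum>t<d. (cmod (gauss_sum p g d t))\<^sup>2) = (real d - 1) * real p + 1"
proof -
  have "(\<Sum>t<d. (cmod (gauss_sum p g d t))\<^sup>2)
      = (cmod (gauss_sum p g d 0))\<^sup>2 + (\<Sum>t\<in>{..<d} - {0}. (cmod (gauss_sum p g d t))\<^sup>2)"
    using d by (intro sum.remove) auto
  also have "(\<Sum>t\<in>{..<d} - {0}. (cmod (gauss_sum p g d t))\<^sup>2) = (\<Sum>t\<in>{..<d} - {0}. real p)"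
    by (intro sum.cong refl norm_gauss_sum) (auto dest: dvd_imp_le)
  finally show ?thesis using d by (simp add: gauss_sum_trivial of_nat_diff)
qed

lemma norm_gauss_correlation:
  assumes "0 < r" "r < d"
  shows "cmod (\<Sum>u<d. gauss_sum p g d (u + r) * cnj (gauss_sum p g d u))
    \<le> (real d - 2) * real p + 2 * sqrt (real p)"
proof -
  define G where "G = gauss_sum p g d"
  have G: "cmod (G t) = (if d dvd t then 1 else sqrt (real p))" for t
    using norm_gauss_sum[of t] gauss_sum_trivial[of t]
    by (auto simp: G_def intro: real_sqrt_unique[symmetric])
  define T where "T u = cmod (G (u + r) * cnj (G u))" for u
  have "cmod (\<Sum>u<d. G (u + r) * cnj (G u)) \<le> (\<Sum>u<d. T u)"
    unfolding T_def by (rule norm_sum)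
  also have "\<dots> = (\<Sum>u\<in>{..<d} - {0, d - r}. T u) + (\<Sum>u\<in>{0, d - r}. T u)"
    using assms by (intro sum.subset_diff) auto
  \<comment> \<open>At \<open>u = 0\<close> the second factor has modulus 1, at
    \<open>u = d - r\<close> the first; the indices differ because \<open>r < d\<close>.\<close>
  also have "(\<Sum>u\<in>{0, d - r}. T u) = 2 * sqrt (real p)"
  proof -
    have "\<not> d dvd r" "\<not> d dvd d - r" using assms by (auto dest: dvd_imp_le)
    with assms show ?thesis by (simp add: T_def norm_mult G)
  qed
  also have "(\<Sum>u\<in>{..<d} - {0, d - r}. T u) = (\<Sum>u\<in>{..<d} - {0, d - r}. real p)"
  proof (intro sum.cong refl)
    fix u assume u: "u \<in> {..<d} - {0, d - r}"
    \<comment> \<open>The only multiple of \<open>d\<close> strictly between 0 and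
      \<open>2 * d\<close> is \<open>d\<close>, and \<open>u + r = d\<close> is excluded.\<close>
    have "\<not> d dvd u" using u by (auto dest: dvd_imp_le)
    moreover have "\<not> d dvd u + r"
    proof
      assume "d dvd u + r"
      then obtain q where q: "u + r = d * q" by blast
      moreover have "u + r < d * 2" "0 < u + r" using u assms by auto
      ultimately have "q = 1" by (cases q) auto
      with q u assms show False by simp
    qed
    ultimately show "T u = real p" by (simp add: T_def norm_mult G)
  qed
  also have "\<dots> = (real d - 2) * real p"
  proof -
    have "card ({..<d} - {0, d - r}) = d - 2"
      using assms by (subst card_Diff_subset) auto
    then show ?thesis using assms by (simp add: of_nat_diff)
  qed
  finally show ?thesis by (simp add: G_def)
qed

text \<open>Shifting the frequency by \<open>r\<close> twists the periods by
  \<open>e_mod d (r * s)\<close>; Parseval then pairs twisted with untwisted periods.\<close>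

lemma gauss_correlation:
  "(\<Sum>u<d. gauss_sum p g d (u + r) * cnj (gauss_sum p g d u))
    = of_nat d * (\<Sum>s<d. e_mod d (real (r * s)) * of_real ((cmod (gauss_period p g d s))\<^sup>2))"
proof -
  have shift: "gauss_sum p g d (u + r)
      = (\<Sum>s<d. e_mod d (real (u * s)) * (e_mod d (real (r * s)) * gauss_period p g d s))" for u
    by (simp add: gauss_sum_def distrib_right e_mod_add mult.assoc)
  show ?thesis
    unfolding shift
    using e_mod_parseval[of d "{..<d}" "\<lambda>s. s" "\<lambda>s. e_mod d (real (r * s)) * gauss_period p g d s"
        "gauss_period p g d"] d
    by (simp add: gauss_sum_def cong_less_modulus_unique_nat complex_norm_square mult.assoc
        del: of_nat_mult cnj_sum of_real_power)
qed

text \<open>Squaring \<open>gauss_correlation\<close> contributes \<open>d^2\<close>, and a second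
  use of Parseval modulo \<open>d\<close> the remaining factor \<open>d\<close>.\<close>

lemma V4_eq_gauss_correlations:
  "V4 p g d * real d ^ 3
    = (\<Sum>r<d. (cmod (\<Sum>u<d. gauss_sum p g d (u + r) * cnj (gauss_sum p g d u)))\<^sup>2)"
proof -
  have "(\<Sum>r<d. (cmod (\<Sum>u<d. gauss_sum p g d (u + r) * cnj (gauss_sum p g d u)))\<^sup>2)
      = (real d)\<^sup>2 * (\<Sum>r<d. (cmod (\<Sum>s<d. e_mod d (real (r * s)) * of_real ((cmod (gauss_period p g d s))\<^sup>2)))\<^sup>2)"
    unfolding gauss_correlation norm_mult norm_of_nat power_mult_distrib
    by (rule sum_distrib_left[symmetric])
  also have "\<dots> = (real d)\<^sup>2 * (real d * V4 p g d)"
    using e_mod_parseval_norm[of d "{..<d}" "\<lambda>s. s" "\<lambda>s. of_real ((cmod (gauss_period p g d s))\<^sup>2)"] d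
    by (simp add: V4_def cong_less_modulus_unique_nat norm_power flip: power_mult)
  finally show ?thesis by (simp add: power2_eq_square power3_eq_cube)
qed

text \<open>The literal \<open>u + 0\<close> keeps the form of the summand \<open>r = 0\<close> of
  \<open>V4_eq_gauss_correlations\<close>.\<close>

lemma gauss_correlation_0:
  "(cmod (\<Sum>u<d. gauss_sum p g d (u + 0) * cnj (gauss_sum p g d u)))\<^sup>2 = ((real d - 1) * real p + 1)\<^sup>2"
proof -
  have "(\<Sum>u<d. gauss_sum p g d (u + 0) * cnj (gauss_sum p g d u))
      = of_real (\<Sum>u<d. (cmod (gauss_sum p g d u))\<^sup>2)"
    by (simp add: complex_norm_square del: of_real_power)
  then show ?thesis unfolding sum_norm_gauss_sum by (simp only: norm_of_real power2_abs)
qed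

lemma V4_lower: "((real d - 1) * real p + 1)\<^sup>2 \<le> V4 p g d * real d ^ 3"
  unfolding V4_eq_gauss_correlations gauss_correlation_0[symmetric]
  using d by (intro member_le_sum) auto

lemma V4_upper:
  "V4 p g d * real d ^ 3
    \<le> ((real d - 1) * real p + 1)\<^sup>2 + (real d - 1) * ((real d - 2) * real p + 2 * sqrt (real p))\<^sup>2"
proof -
  define C where "C r = (cmod (\<Sum>u<d. gauss_sum p g d (u + r) * cnj (gauss_sum p g d u)))\<^sup>2" for r
  have "(\<Sum>r<d. C r) = C 0 + (\<Sum>r\<in>{..<d} - {0}. C r)"
    using d by (intro sum.remove) auto
  also have "(\<Sum>r\<in>{..<d} - {0}. C r)
      \<le> (\<Sum>r\<in>{..<d} - {0}. ((real d - 2) * real p + 2 * sqrt (real p))\<^sup>2)"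
    unfolding C_def by (intro sum_mono power_mono norm_gauss_correlation) auto
  finally show ?thesis
    using d by (simp add: V4_eq_gauss_correlations C_def gauss_correlation_0[simplified] of_nat_diff)
qed

end

theorem theorem4p3:
  fixes p g d :: nat
  assumes "prime p" and "odd p"
    and "residue_primroot p g"
    and "d > 0" and "d dvd p - 1"
  shows "((real d - 1) * real p + 1)\<^sup>2 / real d ^ 3 \<le> V4 p g d
    \<and> V4 p g d \<le> 1 / real d ^ 3 *
           ((real d - 1) * (real d ^ 2 - 3 * real d + 3) * real p ^ 2
            + 4 * (real d - 1) * (real d - 2) * real p powr (3 / 2)
            + 6 * (real d - 1) * real p + 1)"
proof -
  \<comment> \<open>In terms of \<open>q\<close> the half-integral power becomes
    \<open>q ^ 3\<close>, so matching the two bounds is a polynomial identity in \<open>d\<close>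
    and \<open>q\<close>.\<close>
  define q where "q = sqrt (real p)"
  have p: "real p = q\<^sup>2" by (simp add: q_def)
  have "q > 0" using assms(1) by (simp add: q_def prime_gt_0_nat)
  have "real p powr (3 / 2) = (q powr 2) powr (3 / 2)"
    using \<open>q > 0\<close> by (simp add: p powr_numeral)
  also have "\<dots> = q ^ 3"
    using \<open>q > 0\<close> unfolding powr_powr by (simp add: powr_numeral)
  finally have powr: "real p powr (3 / 2) = q ^ 3" .
  have "((real d - 1) * real p + 1)\<^sup>2 + (real d - 1) * ((real d - 2) * real p + 2 * sqrt (real p))\<^sup>2
    = (real d - 1) * (real d ^ 2 - 3 * real d + 3) * real p ^ 2
            + 4 * (real d - 1) * (real d - 2) * real p powr (3 / 2)
            + 6 * (real d - 1) * real p + 1"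
    unfolding powr q_def[symmetric] unfolding p
    by (simp add: power2_eq_square power3_eq_cube algebra_simps)
  with V4_lower[of p g d] V4_upper[of p g d] assms show ?thesis
    by (simp add: field_simps)
qed

end
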